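(* Let $n$ be an even positive integer. Then $$\frac{4}{n(n+1)(n+2)(1+2x)^3}\sum_{k=1}^{n}k(k+1)(k+2)s_k(x)s_{k+1}(x)\in\mathbb{Z}[x].$$
   Context: For an integer $n\ge1$, $s_n(x)$ is the little Schröder polynomial $s_n(x)=\sum_{k=1}^{n}\frac1n\binom{n}{k}\binom{n}{k-1}x^{k-1}(x+1)^{n-k}$. *)

theory Defs
  imports "HOL-Computational_Algebra.Computational_Algebra"
begin

definition little_schroeder :: "nat \<Rightarrow> rat poly" where
  "little_schroeder n =
     (\<Sum>k=1..n. smult (1 / of_nat n * of_nat (n choose k) * of_nat (n choose (k - 1)))
                     ([:0, 1:] ^ (k - 1) * ([:0, 1:] + 1) ^ (n - k)))"

text \<open>\<open>\<int>[x]\<close>, viewed as a subring of the field \<open>\<rat>(x)\<close> of rational functions.\<close>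

definition int_poly_fracts :: "rat poly fract set" where
  "int_poly_fracts = range (\<lambda>q :: int poly. to_fract (map_poly rat_of_int q))"

end

theory Submission
  imports Defs
begin

text \<open>
Write \<open>y = 1 + 2 x\<close> and \<open>z = x (x + 1)\<close>, so that \<open>y\<^sup>2 = 1 + 4 z\<close>. Up to a scalar, \<open>s\<^sub>n\<close> is the
derivative of the Legendre polynomial \<open>P\<^sub>n\<close> at \<open>y\<close>; hence it obeys the three-term recurrence
\<open>(m + 3) s\<^sub>m\<^sub>+\<^sub>2 = (2 m + 3) y s\<^sub>m\<^sub>+\<^sub>1 - m s\<^sub>m\<close> (\<open>little_schroeder_recurrence\<close>).

A Clausen-type phenomenon makes squares and neighbouring products of these polynomials explicit
polynomials in \<open>z\<close>. With \<open>c\<^sub>i = (2i choose i) (2i choose (i + 1))\<close>,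
\<open>k (k + 1) s\<^sub>k\<^sup>2 = \<Sum>i\<ge>1. (k + i choose 2i) c\<^sub>i z^(i - 1)\<close> and
\<open>k (k + 1) (k + 2) s\<^sub>k s\<^sub>k\<^sub>+\<^sub>1 = y \<Sum>i\<ge>1. (2i + 1) (k + i + 1 choose 2i + 1) c\<^sub>i z^(i - 1)\<close>
(\<open>schroeder_products\<close>). The second formula can be summed over \<open>k\<close> by the hockey stick identity:
the sum in the theorem is \<open>y S\<^sub>n(z)\<close>, where the coefficients of \<open>S\<^sub>n\<close> are
\<open>(2i + 1) (n + i + 2 choose 2i + 2) c\<^sub>i\<close> (\<open>sum_schroeder_products\<close>).

Two facts about \<open>S\<^sub>n\<close> finish the proof. Arithmetic: for every \<open>n > 0\<close>, four times each coefficient is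
divisible by \<open>n (n + 1) (n + 2)\<close> (\<open>sum_poly_divisible\<close>). Parity: for even \<open>n\<close>, the summands with
indices \<open>k - 1\<close> and \<open>k\<close>, \<open>k\<close> even, add up to \<open>k (k + 1) (2 k + 1) y s\<^sub>k\<^sup>2\<close>, and \<open>y\<close> divides \<open>s\<^sub>k\<close> because
\<open>s\<^sub>k\<close> is odd under \<open>x \<mapsto> -1 - x\<close>; so \<open>y\<^sup>2\<close> divides \<open>S\<^sub>n(z)\<close> over the rationals (\<open>sum_poly_even\<close>).
Finally, dividing an integer polynomial by \<open>y\<close> creates no denominators, since the constant coefficient of
\<open>y\<close> is 1 (\<open>int_coeffs_cancel\<close>).
\<close>

section \<open>The three-term recurrence\<close>

lemma binomial_Suc_right: "(of_nat (Suc r) :: rat) * of_nat (n choose Suc r) = (of_nat n - of_nat r) * of_nat (n choose r)"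
proof (cases "r \<le> n")
  case True
  have "Suc r * (n choose Suc r) = (n - r) * (n choose r)"
    by (metis binomial_absorb_comp binomial_absorption)
  then show ?thesis using True by (metis of_nat_diff of_nat_mult)
qed (simp add: binomial_eq_0)

text \<open>
The Narayana numbers, with both indices lowered by one: \<open>narayana m j\<close> is usually written
\<open>N(m + 1, j + 1)\<close>. In this form no binomial coefficient has a truncated lower index.
\<close>
definition narayana :: "nat \<Rightarrow> nat \<Rightarrow> rat" where
  "narayana m j = of_nat ((m + 1) choose (j + 1)) * of_nat ((m + 1) choose j) / of_nat (m + 1)"

lemma narayana_eq_0: "j > m \<Longrightarrow> narayana m j = 0"
  by (simp add: narayana_def binomial_eq_0)

text \<open>
Multiplication of a generating function by its variable, on coefficient sequences.
\<close>
definition shift :: "(nat \<Rightarrow> rat) \<Rightarrow> nat \<Rightarrow> rat" where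
  "shift f j = (case j of 0 \<Rightarrow> 0 | Suc i \<Rightarrow> f i)"

text \<open>
Coefficientwise form of
\<open>(p + 4) N\<^sub>p\<^sub>+\<^sub>2(q) = (2 p + 5) (1 + q) N\<^sub>p\<^sub>+\<^sub>1(q) - (p + 1) (1 - q)\<^sup>2 N\<^sub>p(q)\<close> for the Narayana polynomials
\<open>N\<^sub>p\<close>. By Pascal's rule all entries involve only \<open>p + 1 choose i, \<dots>, i + 3\<close> with \<open>j = i + 2\<close>, and these
are rational multiples of the first one. For \<open>j < 2\<close> some of the shifted terms fall off the edge.
\<close>

lemma narayana_recurrence:
  "(of_nat p + 4) * narayana (p + 2) j =
     (2 * of_nat p + 5) * (narayana (p + 1) j + shift (narayana (p + 1)) j)
     - (of_nat p + 1) * (narayana p j - 2 * shift (narayana p) j + shift (shift (narayana p)) j)"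
proof -
  define q :: rat where "q = of_nat p + 1"
  have q: "q \<noteq> 0" "q + 1 \<noteq> 0" "q + 2 \<noteq> 0"
    unfolding q_def by (simp_all add: add_eq_0_iff2 add_nonneg_eq_0_iff)
  have p: "of_nat p = q - 1" by (simp add: q_def)
  consider "j = 0" | "j = 1" | i where "j = i + 2"
    by (metis One_nat_def add_2_eq_Suc' not0_implies_Suc)
  then show ?thesis
  proof cases
    case 1
    then show ?thesis by (simp add: narayana_def shift_def)
  next
    case 2
    define x3 where "x3 = (of_nat (Suc p choose 2) :: rat)"
    have x3: "x3 = q * (q - 1) / 2"
      using binomial_Suc_right[of 1 "Suc p"] by (simp add: x3_def q_def field_simps numeral_2_eq_2)
    have n: "narayana (p + 2) j = x3 + q + (q + 1)"
      "narayana (p + 1) j = x3 + q"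
      "shift (narayana (p + 1)) j = 1"
      "narayana p j = x3 * q / q" "shift (narayana p) j = 1" "shift (shift (narayana p)) j = 0"
      unfolding 2 using q
      by (simp_all add: narayana_def shift_def q_def x3_def numeral_2_eq_2 field_simps)
    show ?thesis unfolding n p x3 using q by (simp add: field_simps)
  next
    case 3
    define x0 where "x0 = (of_nat (Suc p choose i) :: rat)"
    define x1 where "x1 = (of_nat (Suc p choose Suc i) :: rat)"
    define x2 where "x2 = (of_nat (Suc p choose Suc (Suc i)) :: rat)"
    define x3 where "x3 = (of_nat (Suc p choose Suc (Suc (Suc i))) :: rat)"
    define r :: rat where "r = of_nat i"
    have r: "r + 1 \<noteq> 0" "r + 2 \<noteq> 0" "r + 3 \<noteq> 0"
      unfolding r_def by (simp_all add: add_eq_0_iff2 add_nonneg_eq_0_iff)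
    have x1: "x1 = (q - r) / (r + 1) * x0"
      using binomial_Suc_right[of i "Suc p"] r by (simp add: q_def r_def x1_def x0_def field_simps)
    have x2: "x2 = (q - r - 1) / (r + 2) * x1"
      using binomial_Suc_right[of "Suc i" "Suc p"] r
      by (simp add: q_def r_def x1_def x2_def field_simps)
    have x3: "x3 = (q - r - 2) / (r + 3) * x2"
      using binomial_Suc_right[of "Suc (Suc i)" "Suc p"] r
      by (simp add: q_def r_def x3_def x2_def field_simps)
    have *: "(q + 3) * (((x3 + x2 + (x2 + x1)) * (x2 + x1 + (x1 + x0))) / (q + 2))
      = (2 * q + 3) * ((x3 + x2) * (x2 + x1) / (q + 1) + (x2 + x1) * (x1 + x0) / (q + 1))
       - q * (x3 * x2 / q - 2 * (x2 * x1 / q) + x1 * x0 / q)"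
      unfolding x3 x2 x1 using q r by (simp add: divide_simps) algebra
    have n: "narayana (p + 2) j = ((x3 + x2 + (x2 + x1)) * (x2 + x1 + (x1 + x0))) / (q + 2)"
      "narayana (p + 1) j = (x3 + x2) * (x2 + x1) / (q + 1)"
      "shift (narayana (p + 1)) j = (x2 + x1) * (x1 + x0) / (q + 1)"
      "narayana p j = x3 * x2 / q" "shift (narayana p) j = x2 * x1 / q"
      "shift (shift (narayana p)) j = x1 * x0 / q"
      unfolding 3 by (simp_all add: narayana_def shift_def q_def x3_def x2_def x1_def x0_def algebra_simps)
    show ?thesis unfolding n p using * by (simp add: algebra_simps)
  qed
qed

text \<open>
The Schroeder polynomial is the homogenized Narayana polynomial at \<open>x\<close> and \<open>w = x + 1\<close>. Homogeneity turns
\<open>1 + q\<close> into \<open>w + x = y\<close> and \<open>(1 - q)\<^sup>2\<close> into \<open>(w - x)\<^sup>2 = 1\<close>, which is how the Narayana recurrence becomes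
the Legendre-type one.
\<close>
definition homogenize :: "nat \<Rightarrow> (nat \<Rightarrow> rat) \<Rightarrow> rat poly" where
  "homogenize m f = (\<Sum>j\<le>m. smult (f j) ([:0, 1:] ^ j * [:1, 1:] ^ (m - j)))"

lemma homogenize_shift: "homogenize (Suc m) (shift f) = [:0, 1:] * homogenize m f"
  unfolding homogenize_def
  by (subst sum.atMost_Suc_shift)
    (simp add: shift_def sum_distrib_left mult_smult_right mult.assoc
      del: pCons_one mult_pCons_left mult_pCons_right)

lemma homogenize_extend: "f (Suc m) = 0 \<Longrightarrow> homogenize (Suc m) f = [:1, 1:] * homogenize m f"
  by (simp add: homogenize_def sum_distrib_left Suc_diff_le mult_ac
      del: mult_pCons_left mult_pCons_right)

lemma homogenize_add: "homogenize m (\<lambda>j. f j + g j) = homogenize m f + homogenize m g"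
  by (simp add: homogenize_def smult_add_left sum.distrib)

lemma homogenize_diff: "homogenize m (\<lambda>j. f j - g j) = homogenize m f - homogenize m g"
  by (simp add: homogenize_def smult_diff_left sum_subtractf)

lemma homogenize_smult: "homogenize m (\<lambda>j. c * f j) = smult c (homogenize m f)"
proof -
  have "smult c p = [:c:] * p" for p by simp
  then show ?thesis
    by (simp only: homogenize_def sum_distrib_left flip: smult_smult)
qed

lemma little_schroeder_homogenize: "little_schroeder (Suc m) = homogenize m (narayana m)"
proof -
  have "[:0, 1:] + 1 = [:1, 1 :: rat:]" by (simp add: one_pCons)
  then show ?thesis
    unfolding little_schroeder_def homogenize_def One_nat_def sum.atLeast_Suc_atMost_Suc_shift atLeast0AtMost
    by (intro sum.cong refl) (simp add: narayana_def)
qed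

lemma little_schroeder_0 [simp]: "little_schroeder 0 = 0"
  and little_schroeder_1: "little_schroeder (Suc 0) = 1"
  by (simp_all add: little_schroeder_def)

lemma little_schroeder_2: "little_schroeder 2 = [:1, 2:]"
  unfolding numeral_2_eq_2 little_schroeder_homogenize by (simp add: homogenize_def narayana_def)

lemma little_schroeder_recurrence:
  "of_nat (m + 3) * little_schroeder (m + 2) =
     of_nat (2 * m + 3) * [:1, 2:] * little_schroeder (m + 1) - of_nat m * little_schroeder m"
proof (cases m)
  case 0
  then show ?thesis using little_schroeder_2 unfolding numeral_2_eq_2 by (simp add: little_schroeder_1 of_nat_poly numeral_poly)
next
  case (Suc p)
  let ?x = "[:0, 1 :: rat:]" and ?w = "[:1, 1 :: rat:]"
  let ?n = "narayana"
  have "smult (of_nat p + 4) (homogenize (p + 2) (?n (p + 2))) =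
     homogenize (p + 2) (\<lambda>j. (2 * of_nat p + 5) * (?n (p + 1) j + shift (?n (p + 1)) j)
       - (of_nat p + 1) * (?n p j - 2 * shift (?n p) j + shift (shift (?n p)) j))"
    unfolding homogenize_smult[symmetric] narayana_recurrence ..
  also have "\<dots> = smult (2 * of_nat p + 5) (homogenize (p + 2) (?n (p + 1)) + homogenize (p + 2) (shift (?n (p + 1))))
     - smult (of_nat p + 1) (homogenize (p + 2) (?n p) - smult 2 (homogenize (p + 2) (shift (?n p)))
         + homogenize (p + 2) (shift (shift (?n p))))"
    by (simp only: homogenize_add homogenize_diff homogenize_smult)
  also have "homogenize (p + 2) (?n (p + 1)) = ?w * homogenize (p + 1) (?n (p + 1))"
    using homogenize_extend[of "?n (p + 1)" "p + 1"] by (simp add: narayana_eq_0 del: mult_pCons_left)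
  also have "homogenize (p + 2) (shift (?n (p + 1))) = ?x * homogenize (p + 1) (?n (p + 1))"
    using homogenize_shift[of "p + 1" "?n (p + 1)"] by (simp del: mult_pCons_left)
  also have "homogenize (p + 2) (?n p) = ?w * (?w * homogenize p (?n p))"
    using homogenize_extend[of "?n p" p] homogenize_extend[of "?n p" "p + 1"]
    by (simp add: narayana_eq_0 del: mult_pCons_left)
  also have "homogenize (p + 2) (shift (?n p)) = ?w * (?x * homogenize p (?n p))"
    using homogenize_shift[of p "?n p"] homogenize_extend[of "shift (?n p)" "p + 1"]
    by (simp add: narayana_eq_0 shift_def del: mult_pCons_left)
  also have "homogenize (p + 2) (shift (shift (?n p))) = ?x * (?x * homogenize p (?n p))"
    using homogenize_shift[of p "?n p"] homogenize_shift[of "p + 1" "shift (?n p)"] by (simp del: mult_pCons_left)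
  finally have *: "smult (of_nat p + 4) (homogenize (p + 2) (?n (p + 2))) =
    smult (2 * of_nat p + 5) (?w * homogenize (p + 1) (?n (p + 1)) + ?x * homogenize (p + 1) (?n (p + 1)))
    - smult (of_nat p + 1) (?w * (?w * homogenize p (?n p)) - smult 2 (?w * (?x * homogenize p (?n p)))
        + ?x * (?x * homogenize p (?n p)))" .
  have smult: "smult (of_nat p + 4) q = (of_nat p + 4) * q"
    "smult (2 * of_nat p + 5) q = (2 * of_nat p + 5) * q"
    "smult (of_nat p + 1) q = (of_nat p + 1) * q" "smult 2 q = 2 * q" for q :: "rat poly"
    by (simp_all add: of_nat_poly numeral_poly one_pCons mult.commute)
  have "?w = ?x + 1" "[:1, 2:] = 2 * ?x + 1"
    by (simp_all add: one_pCons numeral_poly)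
  with * show ?thesis
    unfolding smult Suc
    using little_schroeder_homogenize[of p] little_schroeder_homogenize[of "p + 1"] little_schroeder_homogenize[of "p + 2"]
    by (simp del: mult_pCons_left mult_pCons_right) algebra
qed

section \<open>Squares and neighbouring products as polynomials in \<open>x (x + 1)\<close>\<close>

text \<open>
The numbers \<open>c\<^sub>i\<close> of the introduction, with \<open>i = j + 1\<close>. The same shift applies to the three polynomials
below, which therefore start at exponent 0: \<open>sq_poly\<close> and \<open>prod_poly\<close> describe the square and the neighbouring
product, and \<open>sum_poly\<close> collects the partial sums of \<open>prod_poly\<close>.
\<close>
definition clausen_coeff :: "nat \<Rightarrow> rat" where
  "clausen_coeff j = of_nat (2 * j + 2 choose (j + 1)) * of_nat (2 * j + 2 choose (j + 2))"

definition sq_poly :: "nat \<Rightarrow> rat poly" where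
  "sq_poly k = (\<Sum>j<k. monom (clausen_coeff j * of_nat (k + j + 1 choose (2 * j + 2))) j)"

definition prod_poly :: "nat \<Rightarrow> rat poly" where
  "prod_poly k = (\<Sum>j<k. monom (clausen_coeff j * of_nat (2 * j + 3) * of_nat (k + j + 2 choose (2 * j + 3))) j)"

definition sum_poly :: "nat \<Rightarrow> rat poly" where
  "sum_poly k = (\<Sum>j<k. monom (clausen_coeff j * of_nat (2 * j + 3) * of_nat (k + j + 3 choose (2 * j + 4))) j)"

lemma coeff_sum_monom: "coeff (\<Sum>j<k. monom (f j) j) i = (if i < k then f i else 0)"
  by (simp add: coeff_sum)

text \<open>
The bound \<open>j < k\<close> of the sums disappears here, as the binomial coefficients are 0 beyond it.
Hence identities between these polynomials need no attention to the upper end.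
\<close>

lemma coeff_sq_poly: "coeff (sq_poly k) j = clausen_coeff j * of_nat (k + j + 1 choose (2 * j + 2))"
  and coeff_prod_poly: "coeff (prod_poly k) j = clausen_coeff j * of_nat (2 * j + 3) * of_nat (k + j + 2 choose (2 * j + 3))"
  and coeff_sum_poly: "coeff (sum_poly k) j = clausen_coeff j * of_nat (2 * j + 3) * of_nat (k + j + 3 choose (2 * j + 4))"
  by (simp_all add: sq_poly_def prod_poly_def sum_poly_def coeff_sum_monom binomial_eq_0)

lemma sum_poly_Suc: "sum_poly (Suc k) = sum_poly k + prod_poly (Suc k)"
  by (rule poly_eqI) (simp add: coeff_sum_poly coeff_prod_poly numeral_eq_Suc algebra_simps)

text \<open>
The counterpart of
\<open>k (k + 1) (k + 2) s\<^sub>k s\<^sub>k\<^sub>+\<^sub>1 + (k - 1) k (k + 1) s\<^sub>k\<^sub>-\<^sub>1 s\<^sub>k = k (k + 1) (2 k + 1) y s\<^sub>k\<^sup>2\<close>,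
which is the three-term recurrence multiplied by a multiple of \<open>s\<^sub>k\<close>.
\<close>

lemma prod_poly_Suc: "prod_poly (Suc m) = smult (of_nat (2 * m + 3)) (sq_poly (Suc m)) - prod_poly m"
proof (rule poly_eqI)
  fix j
  have "rat_of_nat (2 * j + 3) * of_nat (m + j + 2 choose (2 * j + 3)) = (of_nat m - of_nat j) * of_nat (m + j + 2 choose (2 * j + 2))"
    using binomial_Suc_right[of "2 * j + 2" "m + j + 2"] by (simp add: numeral_eq_Suc)
  moreover define a b where "a = rat_of_nat (m + j + 2 choose (2 * j + 3))"
    and "b = rat_of_nat (m + j + 2 choose (2 * j + 2))"
  ultimately have "rat_of_nat (2 * j + 3) * a = (of_nat m - of_nat j) * b" by simp
  then have "clausen_coeff j * of_nat (2 * j + 3) * (a + b) = of_nat (2 * m + 3) * (clausen_coeff j * b) - clausen_coeff j * of_nat (2 * j + 3) * a"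
    by (simp add: algebra_simps) algebra
  moreover have pascal: "rat_of_nat (Suc m + j + 2 choose (2 * j + 3)) = a + b"
    by (simp add: a_def b_def numeral_eq_Suc)
  ultimately show "coeff (prod_poly (Suc m)) j = coeff (smult (of_nat (2 * m + 3)) (sq_poly (Suc m)) - prod_poly m) j"
    using pascal by (simp add: coeff_prod_poly coeff_sq_poly a_def b_def del: binomial_Suc_Suc)
qed

lemma clausen_coeff_Suc: "(of_nat j + 1) * (of_nat j + 3) * clausen_coeff (Suc j) = 4 * (2 * of_nat j + 3) ^ 2 * clausen_coeff j"
proof -
  define r u x where "r = rat_of_nat j" and "u = (fact j :: rat)" and "x = (fact (2 * j + 2) :: rat)"
  have nz: "u \<noteq> 0" "r + 1 \<noteq> 0" "r + 2 \<noteq> 0" "r + 3 \<noteq> 0"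
    unfolding u_def r_def by (simp_all add: add_eq_0_iff2 add_nonneg_eq_0_iff)
  have cc: "clausen_coeff j = fact (2 * j + 2) ^ 2 / (fact (j + 1) ^ 2 * fact j * fact (j + 2))" for j
    using binomial_fact[of "j + 1" "2 * j + 2", where 'a = rat]
      binomial_fact[of "j + 2" "2 * j + 2", where 'a = rat]
    unfolding clausen_coeff_def by (simp add: power2_eq_square del: binomial_Suc_Suc fact_Suc)
  have f: "fact (j + 1) = (r + 1) * u" "fact (Suc j) = (r + 1) * u" "fact (j + 2) = (r + 2) * ((r + 1) * u)"
    "fact (Suc j + 1) = (r + 2) * ((r + 1) * u)" "fact (Suc j + 2) = (r + 3) * ((r + 2) * ((r + 1) * u))"
    "fact (2 * Suc j + 2) = 2 * (r + 2) * ((2 * r + 3) * x)"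
    unfolding u_def r_def x_def by (simp_all add: numeral_eq_Suc algebra_simps)
  have "g * h * ((2 * e * (q * x))^2 / ((e * (g * u))^2 * (g * u) * (h * (e * (g * u)))))
      = 4 * q^2 * (x^2 / ((g * u)^2 * u * (e * (g * u))))"
    if "g \<noteq> 0" "e \<noteq> 0" "h \<noteq> 0" for g q e h
    using that nz by (simp add: field_simps power2_eq_square)
  from this[of "r + 1" "r + 2" "r + 3" "2 * r + 3"] nz show ?thesis
    unfolding cc f r_def[symmetric] u_def[symmetric] x_def[symmetric] by blast
qed

text \<open>
The counterpart of the squared three-term recurrence, whose mixed term is a neighbouring product;
\<open>[:1, 4:]\<close> stands for \<open>y\<^sup>2 = 1 + 4 z\<close>. In the proof all binomial coefficients entering the coefficient at
\<open>j + 1\<close> are expressed through \<open>m + j + 2 choose 2 j + 2\<close>.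
\<close>

lemma sq_poly_recurrence:
  "smult (of_nat ((m + 1) * (m + 3))) (sq_poly (m + 2)) =
     smult (of_nat ((2 * m + 3) ^ 2)) ([:1, 4:] * sq_poly (m + 1))
     - smult (of_nat (2 * (2 * m + 3))) ([:1, 4:] * prod_poly m)
     + smult (of_nat (m * (m + 2))) (sq_poly m)"
proof (rule poly_eqI)
  fix i
  define k :: rat where "k = of_nat m"
  show "coeff (smult (of_nat ((m + 1) * (m + 3))) (sq_poly (m + 2))) i =
     coeff (smult (of_nat ((2 * m + 3) ^ 2)) ([:1, 4:] * sq_poly (m + 1))
     - smult (of_nat (2 * (2 * m + 3))) ([:1, 4:] * prod_poly m)
     + smult (of_nat (m * (m + 2))) (sq_poly m)) i"
  proof (cases i)
    case 0
    have 2: "rat_of_nat (n choose 2) = of_nat n * (of_nat n - 1) / 2" for n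
      using binomial_Suc_right[of 1 n] by (simp add: numeral_2_eq_2 field_simps)
    have 3: "rat_of_nat (n choose 3) = of_nat n * (of_nat n - 1) * (of_nat n - 2) / 6" for n
      using binomial_Suc_right[of 2 n] 2[of n] by (simp add: numeral_3_eq_3 field_simps)
    show ?thesis unfolding 0
      by (simp add: coeff_sq_poly coeff_prod_poly 2 3 clausen_coeff_def coeff_mult_0 del: mult_pCons_left mult_pCons_right)
        (simp add: k_def[symmetric] 2[unfolded numeral_2_eq_2] field_simps power2_eq_square)
  next
    case (Suc j)
    define r :: rat where "r = of_nat j"
    define e where "e = rat_of_nat (m + j + 2 choose (2 * j + 2))"
    define g1 where "g1 = rat_of_nat (m + j + 2 choose (2 * j + 3))"
    define g2 where "g2 = rat_of_nat (m + j + 2 choose (2 * j + 4))"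
    define g3 where "g3 = rat_of_nat (m + j + 3 choose (2 * j + 5))"
    have r: "r + 1 \<noteq> 0" "r + 2 \<noteq> 0" "r + 3 \<noteq> 0" "2 * r + 3 \<noteq> 0"
      unfolding r_def by (simp_all add: add_eq_0_iff2 add_nonneg_eq_0_iff)
    have 1: "(2 * r + 3) * g1 = (k - r) * e"
      using binomial_Suc_right[of "2 * j + 2" "m + j + 2"]
      by (simp add: r_def k_def e_def g1_def numeral_eq_Suc algebra_simps)
    have 2: "(2 * r + 4) * g2 = (k - r - 1) * g1"
      using binomial_Suc_right[of "2 * j + 3" "m + j + 2"]
      by (simp add: r_def k_def g2_def g1_def numeral_eq_Suc algebra_simps)
    have 3: "(2 * r + 5) * g3 = (k - r - 1) * (g1 + g2)"
      using binomial_Suc_right[of "2 * j + 4" "m + j + 3"]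
      by (simp add: r_def k_def g2_def g1_def g3_def numeral_eq_Suc algebra_simps)
    have c: "(r + 1) * (r + 3) * clausen_coeff (Suc j) = 4 * (2 * r + 3) ^ 2 * clausen_coeff j"
      using clausen_coeff_Suc[of j] by (simp add: r_def)
    have co: "coeff (sq_poly (m + 2)) i = clausen_coeff (Suc j) * (e + 2 * g1 + g2)"
      "coeff (sq_poly (m + 1)) i = clausen_coeff (Suc j) * (g1 + g2)"
      "coeff (sq_poly (m + 1)) j = clausen_coeff j * e"
      "coeff (sq_poly m) i = clausen_coeff (Suc j) * g2"
      "coeff (prod_poly m) i = clausen_coeff (Suc j) * ((2 * r + 5) * g3)"
      "coeff (prod_poly m) j = clausen_coeff j * ((2 * r + 3) * g1)"
      unfolding Suc coeff_sq_poly coeff_prod_poly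
      by (simp_all add: numeral_eq_Suc e_def g1_def g2_def g3_def r_def algebra_simps)
    have "(k + 1) * (k + 3) * (clausen_coeff (Suc j) * (e + 2 * g1 + g2)) =
      (2 * k + 3) ^ 2 * (clausen_coeff (Suc j) * (g1 + g2) + 4 * (clausen_coeff j * e))
      - 2 * (2 * k + 3) * (clausen_coeff (Suc j) * ((2 * r + 5) * g3) + 4 * (clausen_coeff j * ((2 * r + 3) * g1)))
      + k * (k + 2) * (clausen_coeff (Suc j) * g2)"
    proof -
      have g1: "g1 = (k - r) / (2 * r + 3) * e" using 1 r by (simp add: field_simps)
      have g2: "g2 = (k - r - 1) / (2 * (r + 2)) * g1" using 2 r by (simp add: field_simps)
      have cj: "clausen_coeff j = (r + 1) * (r + 3) * clausen_coeff (Suc j) / (4 * (2 * r + 3) ^ 2)"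
        using c r by (simp add: field_simps)
      show ?thesis
        unfolding 3 1 unfolding cj g2 g1 using r by (simp add: divide_simps) algebra
    qed
    moreover have "coeff ([:1, 4:] * p) i = coeff p i + 4 * coeff p j" for p :: "rat poly"
      by (simp add: Suc)
    ultimately show ?thesis
      by (simp only: coeff_add coeff_diff coeff_smult co of_nat_mult of_nat_add of_nat_power
          of_nat_1 of_nat_numeral flip: k_def)
  qed
qed

lemma smult_of_nat: "smult (of_nat a) p = of_nat a * (p :: rat poly)"
  by (simp add: of_nat_poly)

definition x_x1 :: "rat poly" where "x_x1 = [:0, 1, 1:]"

text \<open>
The recurrences of both sides agree. The one for squares reaches back two steps, so the induction carries the
squares at \<open>m\<close> and \<open>m + 1\<close> together with the product that links them.
\<close>

lemma schroeder_products:
  "of_nat (m * (m + 1)) * little_schroeder m ^ 2 = sq_poly m \<circ>\<^sub>p x_x1 \<and>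
   of_nat ((m + 1) * (m + 2)) * little_schroeder (m + 1) ^ 2 = sq_poly (m + 1) \<circ>\<^sub>p x_x1 \<and>
   of_nat (m * (m + 1) * (m + 2)) * little_schroeder m * little_schroeder (m + 1)
      = [:1, 2:] * (prod_poly m \<circ>\<^sub>p x_x1)"
proof (induction m)
  case 0
  show ?case by (simp add: sq_poly_def prod_poly_def little_schroeder_1 clausen_coeff_def monom_0 numeral_poly)
next
  case (Suc m)
  define s0 where "s0 = little_schroeder m"
  define s1 where "s1 = little_schroeder (m + 1)"
  define s2 where "s2 = little_schroeder (m + 2)"
  define k :: "rat poly" where "k = of_nat m"
  define y :: "rat poly" where "y = [:1, 2:]"
  define A0 where "A0 = sq_poly m \<circ>\<^sub>p x_x1"
  define A1 where "A1 = sq_poly (m + 1) \<circ>\<^sub>p x_x1"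
  define A2 where "A2 = sq_poly (m + 2) \<circ>\<^sub>p x_x1"
  define B0 where "B0 = prod_poly m \<circ>\<^sub>p x_x1"
  define B1 where "B1 = prod_poly (m + 1) \<circ>\<^sub>p x_x1"
  have IH: "k * (k + 1) * s0 ^ 2 = A0" "(k + 1) * (k + 2) * s1 ^ 2 = A1"
    "k * (k + 1) * (k + 2) * s0 * s1 = y * B0"
    using Suc.IH
    unfolding of_nat_mult of_nat_add of_nat_1 of_nat_numeral
      k_def s0_def s1_def A0_def A1_def B0_def y_def by blast+
  have rec: "(k + 3) * s2 = (2 * k + 3) * y * s1 - k * s0"
    using little_schroeder_recurrence[of m]
    by (simp add: k_def s0_def s1_def s2_def y_def del: mult_pCons_left mult_pCons_right)
  have "[:1, 4:] \<circ>\<^sub>p x_x1 = y ^ 2"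
    by (simp add: x_x1_def y_def power2_eq_square pcompose_pCons)
  then have A2: "(k + 1) * (k + 3) * A2 = (2 * k + 3) ^ 2 * (y ^ 2 * A1) - 2 * (2 * k + 3) * (y ^ 2 * B0) + k * (k + 2) * A0"
    using arg_cong[OF sq_poly_recurrence[of m], of "\<lambda>p. p \<circ>\<^sub>p x_x1"]
    unfolding pcompose_add pcompose_diff pcompose_smult pcompose_mult
    unfolding A2_def A1_def A0_def B0_def k_def
    unfolding smult_of_nat by (simp only: of_nat_mult of_nat_add of_nat_power of_nat_1 of_nat_numeral)
  have B1: "B1 = (2 * k + 3) * A1 - B0"
    using arg_cong[OF prod_poly_Suc[of m], of "\<lambda>p. p \<circ>\<^sub>p x_x1"]
    unfolding B1_def A1_def B0_def k_def pcompose_diff pcompose_smult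
    unfolding smult_of_nat by simp
  have "(k + 1) * (k + 3) * ((k + 2) * (k + 3) * s2 ^ 2) = (k + 1) * (k + 3) * A2"
    unfolding A2 IH(1,2)[symmetric] using IH(3) rec by algebra
  moreover have "(k + 1) * (k + 3) \<noteq> 0"
    unfolding k_def by (simp add: of_nat_poly numeral_poly one_pCons add_eq_0_iff2)
  ultimately have 2: "(k + 2) * (k + 3) * s2 ^ 2 = A2" by simp
  have 3: "(k + 1) * (k + 2) * (k + 3) * s1 * s2 = y * B1"
  proof -
    have "(k + 1) * (k + 2) * (k + 3) * s1 * s2 = (k + 1) * (k + 2) * s1 * ((k + 3) * s2)"
      by (simp only: mult_ac)
    also have "\<dots> = y * ((2 * k + 3) * ((k + 1) * (k + 2) * s1 ^ 2)) - k * (k + 1) * (k + 2) * s0 * s1"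
      unfolding rec by algebra
    finally show ?thesis
      unfolding IH(2,3) B1 by (simp only: right_diff_distrib)
  qed
  have e: "Suc m = m + 1" "m + 1 + 1 = m + 2" "m + 1 + 2 = m + 3" by simp_all
  show ?case
    using IH(2) 2 3
    unfolding e of_nat_mult of_nat_add of_nat_1 of_nat_numeral
      k_def s2_def s1_def A2_def A1_def B1_def y_def by blast
qed

text \<open>
On coefficients the summation is the hockey stick identity, through \<open>sum_poly_Suc\<close>.
\<close>

lemma sum_schroeder_products:
  "(\<Sum>k=1..n. of_nat (k * (k + 1) * (k + 2)) * little_schroeder k * little_schroeder (k + 1))
     = [:1, 2:] * (sum_poly n \<circ>\<^sub>p x_x1)"
proof (induction n)
  case 0
  show ?case by (simp add: sum_poly_def)
next
  case (Suc n)
  then show ?case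
    using schroeder_products[of "Suc n"]
    by (simp add: sum_poly_Suc pcompose_add algebra_simps del: mult_pCons_left mult_pCons_right of_nat_mult of_nat_add of_nat_Suc)
qed

section \<open>Divisibility of the coefficients\<close>

lemma binomial_fact_add: "a + b = n \<Longrightarrow> rat_of_nat (n choose a) = fact n / (fact a * fact b)"
  by (auto simp add: binomial_fact)

text \<open>
With \<open>i = j + 1\<close>, twice the coefficient \<open>\<sigma>\<close> is both \<open>n (n + 1) a\<close> and \<open>(n + 2) b\<close> for the integers
\<open>a = C\<^sub>i (n + i + 2 choose i + 1) (n - 1 choose i - 1)\<close>, where \<open>C\<^sub>i\<close> is a Catalan number, and
\<open>b = (2i choose i + 1) (n + i + 2 choose i) (n + 1 choose i + 1)\<close>. The two divisors are nearly coprime: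
\<open>n (n + 1) - (n - 1) (n + 2) = 2\<close>. Hence \<open>4 \<sigma> = n (n + 1) (n + 2) (b - (n - 1) a)\<close>.
\<close>

lemma sum_poly_divisible:
  assumes "n > 0"
  shows "\<exists>q :: int. 4 * coeff (sum_poly n) j = of_nat (n * (n + 1) * (n + 2)) * of_int q"
proof (cases "j < n")
  case False
  then have "coeff (sum_poly n) j = 0" by (simp add: coeff_sum_poly binomial_eq_0)
  then show ?thesis by (intro exI[of _ 0]) simp
next
  case True
  then obtain d where n: "n = j + 1 + d" using less_iff_Suc_add by auto
  \<comment> \<open>Everything is written as a monomial in five factorials and a few linear factors, where \<open>s = n - 1\<close>.\<close>
  define r t s where "r = rat_of_nat j" and "t = rat_of_nat d" and "s = r + t"
  define u v w x y where "u = (fact j :: rat)" and "v = (fact d :: rat)"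
    and "w = (fact (j + d) :: rat)" and "x = (fact (2 * j + 2) :: rat)" and "y = (fact (2 * j + d + 4) :: rat)"
  have nz: "u \<noteq> 0" "v \<noteq> 0" "w \<noteq> 0" "x \<noteq> 0" "y \<noteq> 0" "r + 1 \<noteq> 0" "r + 2 \<noteq> 0"
    "2 * r + 3 \<noteq> 0" "s + 1 \<noteq> 0" "s + 2 \<noteq> 0" "s + 3 \<noteq> 0"
    unfolding u_def v_def w_def x_def y_def r_def t_def s_def
    by (simp_all add: add_eq_0_iff2 add_nonneg_eq_0_iff)
  have f: "fact (j + 1) = (r + 1) * u" "fact (j + 2) = (r + 2) * ((r + 1) * u)"
    "fact (2 * j + 4) = 2 * (r + 2) * ((2 * r + 3) * x)"
    "fact (j + d + 2) = (s + 2) * ((s + 1) * w)" "fact (j + d + 3) = (s + 3) * ((s + 2) * ((s + 1) * w))"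
    unfolding u_def v_def w_def x_def y_def r_def t_def s_def
    by (simp_all add: numeral_eq_Suc algebra_simps)
  define A B C D E F G where "A = (2 * j + 2 choose (j + 1))" and "B = (2 * j + 2 choose (j + 2))"
    and "C = (2 * j + d + 4 choose (2 * j + 4))" and "D = (2 * j + d + 4 choose (j + 2))"
    and "E = (2 * j + d + 4 choose (j + 1))" and "F = (j + d choose j)" and "G = (j + d + 2 choose (j + 2))"
  have "rat_of_nat A = fact (2 * j + 2) / (fact (j + 1) * fact (j + 1))"
    "rat_of_nat B = fact (2 * j + 2) / (fact (j + 2) * fact j)"
    "rat_of_nat C = fact (2 * j + d + 4) / (fact (2 * j + 4) * fact d)"
    "rat_of_nat D = fact (2 * j + d + 4) / (fact (j + 2) * fact (j + d + 2))"
    "rat_of_nat E = fact (2 * j + d + 4) / (fact (j + 1) * fact (j + d + 3))"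
    "rat_of_nat F = fact (j + d) / (fact j * fact d)"
    "rat_of_nat G = fact (j + d + 2) / (fact (j + 2) * fact d)"
    unfolding A_def B_def C_def D_def E_def F_def G_def by (rule binomial_fact_add, simp)+
  note b = this[unfolded f, folded u_def v_def w_def x_def y_def]
  \<comment> \<open>\<open>A - B\<close> is the Catalan number.\<close>
  define a b where "a = (int A - int B) * int D * int F" and "b = int B * int E * int G"
  define \<sigma> where "\<sigma> = coeff (sum_poly n) j"
  have \<sigma>: "\<sigma> = rat_of_nat A * rat_of_nat B * (2 * r + 3) * rat_of_nat C"
  proof -
    have "n + j + 3 = 2 * j + d + 4" using n by simp
    then show ?thesis
      unfolding \<sigma>_def coeff_sum_poly clausen_coeff_def A_def B_def C_def r_def
      by (simp only: of_nat_mult of_nat_add of_nat_numeral)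
  qed
  have AB: "(r + 2) * rat_of_nat B = (r + 1) * rat_of_nat A"
    unfolding b using nz by simp
  have 1: "2 * \<sigma> = (s + 1) * (s + 2) * of_int a"
  proof -
    have "2 * rat_of_nat B * (2 * r + 3) * rat_of_nat C * (r + 2)
        = (s + 1) * (s + 2) * rat_of_nat D * rat_of_nat F"
    proof -
      have "2 * (x / (p * u)) * q * (y / ((2 * e) * (q * x) * v)) * e
        = c * c' * (y / (p * (c' * (c * w)))) * (w / (u * v))"
        if "p \<noteq> 0" "q \<noteq> 0" "e \<noteq> 0" "c \<noteq> 0" "c' \<noteq> 0" for p q e c c'
        using nz that by simp
      from this[of "(r + 2) * ((r + 1) * u)" "2 * r + 3" "r + 2" "s + 1" "s + 2"] nz
      show ?thesis unfolding b by (simp only: mult_eq_0_iff simp_thms)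
    qed
    moreover have "(r + 2) * (rat_of_nat A - rat_of_nat B) = rat_of_nat A"
      using AB by algebra
    ultimately have "(r + 2) * (2 * \<sigma>) = (r + 2) * ((s + 1) * (s + 2) * of_int a)"
      unfolding \<sigma> a_def of_int_mult of_int_diff of_int_of_nat_eq by algebra
    then show ?thesis using nz by simp
  qed
  have 2: "2 * \<sigma> = (s + 3) * of_int b"
  proof -
    have "2 * (x / (p * p)) * q * (y / ((2 * e) * (q * x) * v))
        = c'' * (y / (p * (c'' * (c' * (c * w))))) * (c' * (c * w) / (e * p * v))"
      if "p \<noteq> 0" "q \<noteq> 0" "e \<noteq> 0" "c \<noteq> 0" "c' \<noteq> 0" "c'' \<noteq> 0" for p q e c c' c''
      using nz that by simp
    from this[of "(r + 1) * u" "2 * r + 3" "r + 2" "s + 1" "s + 2" "s + 3"] nz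
    have "2 * rat_of_nat A * (2 * r + 3) * rat_of_nat C = (s + 3) * rat_of_nat E * rat_of_nat G"
      unfolding b by simp
    then show ?thesis
      unfolding \<sigma> b_def of_int_mult of_int_of_nat_eq by algebra
  qed
  have "4 * \<sigma> = (s + 1) * (s + 2) * (s + 3) * (of_int b - s * of_int a)"
    using 1 2 by algebra
  then show ?thesis
    by (intro exI[of _ "b - int (j + d) * a"])
      (simp add: \<sigma>_def n s_def r_def t_def algebra_simps)
qed

section \<open>Integer coefficients and division by \<open>1 + 2 x\<close>\<close>
definition int_coeffs :: "rat poly \<Rightarrow> bool" where
  "int_coeffs p \<longleftrightarrow> (\<forall>i. coeff p i \<in> \<int>)"

lemma int_coeffs_add: "int_coeffs p \<Longrightarrow> int_coeffs q \<Longrightarrow> int_coeffs (p + q)"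
  by (simp add: int_coeffs_def)

lemma int_coeffs_mult: "int_coeffs p \<Longrightarrow> int_coeffs q \<Longrightarrow> int_coeffs (p * q)"
  by (simp add: int_coeffs_def coeff_mult Ints_sum)

lemma int_coeffs_pcompose: "int_coeffs p \<Longrightarrow> int_coeffs q \<Longrightarrow> int_coeffs (p \<circ>\<^sub>p q)"
proof (induction p)
  case (pCons a p)
  have "int_coeffs p" "int_coeffs [:a:]"
    using pCons.prems(1) by (auto simp: int_coeffs_def coeff_pCons split: nat.splits)
  then show ?case
    using pCons by (simp add: pcompose_pCons int_coeffs_add int_coeffs_mult)
qed (simp add: int_coeffs_def)

text \<open>
As the constant coefficient of \<open>1 + 2 x\<close> is 1, the coefficients of the quotient are computed recursively from
those of the product without any division.
\<close>

lemma int_coeffs_cancel: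
  assumes "int_coeffs ([:1, 2:] * p)"
  shows "int_coeffs p"
proof -
  have "coeff p i \<in> \<int>" for i
  proof (induction i)
    case 0
    have "coeff p 0 = coeff ([:1, 2:] * p) 0" by simp
    then show ?case using assms unfolding int_coeffs_def by metis
  next
    case (Suc i)
    have "coeff p (Suc i) = coeff ([:1, 2:] * p) (Suc i) - 2 * coeff p i" by simp
    then show ?case using assms Suc unfolding int_coeffs_def
      by (metis Ints_diff Ints_mult Ints_numeral)
  qed
  then show ?thesis by (simp add: int_coeffs_def)
qed

text \<open>
At even \<open>m\<close> the recurrence expresses \<open>s\<^sub>m\<^sub>+\<^sub>2\<close> by a multiple of \<open>y\<close> and a multiple of \<open>s\<^sub>m\<close>, starting from
\<open>s\<^sub>0 = 0\<close>, the empty sum.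
\<close>

lemma little_schroeder_even: "[:1, 2:] dvd little_schroeder (2 * m)"
proof (induction m)
  case (Suc m)
  have "[:1, 2:] dvd of_nat (2 * m + 3) * little_schroeder (2 * m + 2)"
    unfolding little_schroeder_recurrence using Suc
    by (intro dvd_diff dvd_mult dvd_mult2[OF dvd_triv_right]) auto
  then show ?case
    by (simp add: of_nat_poly dvd_smult_iff del: of_nat_Suc)
qed simp

lemma sum_poly_even: "[:1, 2:] ^ 2 dvd sum_poly (2 * m) \<circ>\<^sub>p x_x1"
proof (induction m)
  case 0
  show ?case by (simp add: sum_poly_def)
next
  case (Suc m)
  \<comment> \<open>Two consecutive summands combine into a multiple of one square, at the even index.\<close>
  have sum: "sum_poly (2 * Suc m) = sum_poly (2 * m) + smult (of_nat (4 * m + 5)) (sq_poly (2 * Suc m))"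
    by (simp add: sum_poly_Suc prod_poly_Suc[of "Suc (2 * m)"] add.commute)
  have sq: "of_nat (2 * Suc m * (2 * Suc m + 1)) * little_schroeder (2 * Suc m) ^ 2 = sq_poly (2 * Suc m) \<circ>\<^sub>p x_x1"
    using schroeder_products[of "2 * Suc m"] by (rule conjunct1)
  have "[:1, 2:] ^ 2 dvd little_schroeder (2 * Suc m) ^ 2"
    by (rule dvd_power_same[OF little_schroeder_even])
  then have "[:1, 2:] ^ 2 dvd sq_poly (2 * Suc m) \<circ>\<^sub>p x_x1"
    unfolding sq[symmetric] by (rule dvd_mult)
  then show ?case
    unfolding sum pcompose_add pcompose_smult by (intro dvd_add dvd_smult Suc.IH)
qed

section \<open>The quotient is an integer polynomial\<close>

lemma to_fract_of_nat: "to_fract (of_nat k) = of_nat k"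
  by (induction k) auto

theorem theorem3:
  fixes n :: nat
  assumes "n > 0" and "even n"
  shows "4 / to_fract (of_nat (n * (n + 1) * (n + 2)) * (1 + 2 * [:0, 1:]) ^ 3)
           * to_fract (\<Sum>k=1..n. of_nat (k * (k + 1) * (k + 2))
                                 * little_schroeder k * little_schroeder (k + 1))
         \<in> int_poly_fracts"
proof -
  define y :: "rat poly" where "y = [:1, 2:]"
  define N where "N = n * (n + 1) * (n + 2)"
  have N: "N > 0" using assms by (simp add: N_def)
  obtain m where "n = 2 * m" using assms(2) by (rule evenE)
  then have "y ^ 2 dvd sum_poly n \<circ>\<^sub>p x_x1"
    unfolding y_def by (simp only: sum_poly_even)
  then obtain R where R: "sum_poly n \<circ>\<^sub>p x_x1 = y ^ 2 * R" by (rule dvdE)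
  define P where "P = smult (4 / of_nat N) R"
  have "int_coeffs (smult (4 / of_nat N) (sum_poly n))"
    unfolding int_coeffs_def
  proof
    fix i
    obtain q :: int where "4 * coeff (sum_poly n) i = of_nat N * of_int q"
      using sum_poly_divisible[OF assms(1)] unfolding N_def by blast
    then have "coeff (smult (4 / of_nat N) (sum_poly n)) i = of_int q"
      using N by (simp add: field_simps)
    then show "coeff (smult (4 / of_nat N) (sum_poly n)) i \<in> \<int>" by simp
  qed
  moreover have "int_coeffs x_x1"
    by (auto simp: int_coeffs_def x_x1_def coeff_pCons split: nat.splits)
  ultimately have "int_coeffs (smult (4 / of_nat N) (sum_poly n) \<circ>\<^sub>p x_x1)"
    by (rule int_coeffs_pcompose)
  then have "int_coeffs (y * (y * P))"
    by (simp add: pcompose_smult R P_def power2_eq_square mult.assoc)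
  then have "int_coeffs P"
    unfolding y_def by (rule int_coeffs_cancel[OF int_coeffs_cancel])
  then have P: "P = map_poly of_int (map_poly floor P)"
    by (intro poly_eqI) (simp add: coeff_map_poly int_coeffs_def)
  have 4: "to_fract (4 :: rat poly) = 4"
    using to_fract_of_nat[of 4] by simp
  have "4 * (y * (sum_poly n \<circ>\<^sub>p x_x1)) = (of_nat N * y ^ 3) * P"
    using N by (simp add: R P_def of_nat_poly numeral_poly power2_eq_square power3_eq_cube mult.assoc)
  then have "to_fract (4 * (y * (sum_poly n \<circ>\<^sub>p x_x1))) = to_fract ((of_nat N * y ^ 3) * P)"
    by (rule arg_cong)
  then have "4 * to_fract (y * (sum_poly n \<circ>\<^sub>p x_x1)) = to_fract (of_nat N * y ^ 3) * to_fract P"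
    by (simp only: to_fract_mult 4)
  moreover have "to_fract (of_nat N * y ^ 3) \<noteq> 0"
    using N by (simp add: y_def del: to_fract_mult)
  moreover have "4 / a * t = p" if "4 * t = a * p" "a \<noteq> 0" for a t p :: "rat poly fract"
    using that by simp
  ultimately have "4 / to_fract (of_nat N * y ^ 3) * to_fract (y * (sum_poly n \<circ>\<^sub>p x_x1)) = to_fract P"
    by blast
  moreover have "1 + 2 * [:0, 1:] = y"
    by (simp add: y_def numeral_poly one_pCons)
  ultimately have "4 / to_fract (of_nat (n * (n + 1) * (n + 2)) * (1 + 2 * [:0, 1:]) ^ 3)
      * to_fract (\<Sum>k=1..n. of_nat (k * (k + 1) * (k + 2)) * little_schroeder k * little_schroeder (k + 1))
    = to_fract P"
    by (simp only: sum_schroeder_products y_def N_def)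
  then show ?thesis
    unfolding int_poly_fracts_def using P by (metis rangeI)
qed

end
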